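(* Let $\nu>0$, $\lambda>0$, $\alpha>0$. Let $f\in C(\mathbb R,\ell_2)$ be translation-compact (i.e. $\{f^h : h\in\mathbb R\}$ is precompact in $C(\mathbb R,\ell_2)$), and let $F\in C(\mathbb R,\mathbb R)$ be Lipschitz continuous on bounded sets with $F(0)=0$ and $sF(s)\le -\alpha s^2$ for all $s\in\mathbb R$. Let $C:=\sup\{\|f(t)\| : t\in\mathbb R\}$ and $$Q:=\Big\{u\in\ell_2 : \|u\|^2\le 1+\frac{C^2}{\lambda(\lambda+2\alpha)}\Big\}.$$ Then the cocycle $\langle\ell_2,\varphi,(H(f),\mathbb R,\sigma)\rangle$ generated by the equation $u'=\nu\Lambda u-\lambda u+\widetilde F(u)+f(t)$ satisfies the asymptotic tails property on the set $Q$; that is, for every $\varepsilon>0$ there exist $L(\varepsilon)>0$ and $k_\varepsilon\in\mathbb N$ such that $$\sum_{|k|\ge k_\varepsilon}|\varphi_k(t,v,g)|^2<\varepsilon$$ for all $t\ge L(\varepsilon)$ and all $(v,g)\in Q\times H(f)$.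
   Context: $\ell_2$ is the Hilbert space of real two-sided square-summable sequences $u=(u_i)_{i\in\mathbb Z}$ with norm $\|\cdot\|$. $(\Lambda u)_i:=u_{i-1}-2u_i+u_{i+1}$ (a bounded linear operator on $\ell_2$) and $\widetilde F(u)_i:=F(u_i)$ (which maps $\ell_2$ to $\ell_2$ when $F(0)=0$ and $F$ is Lipschitz on bounded sets). $C(\mathbb R,\ell_2)$ is the space of continuous functions $\mathbb R\to\ell_2$ with the compact-open topology (uniform convergence on compact intervals). $f^h(t):=f(t+h)$; $H(f)$ is the closure of $\{f^h: h\in\mathbb R\}$ in $C(\mathbb R,\ell_2)$; $\sigma(h,g):=g^h$. For $(v,g)\in\ell_2\times H(f)$, $\varphi(t,v,g)$ ($t\ge0$) denotes the unique solution, defined on $[0,+\infty)$, of $u'=\nu\Lambda u-\lambda u+\widetilde F(u)+g(t)$, $u(0)=v$, and $\varphi_k(t,v,g)$ is its $k$-th coordinate. The map $\varphi$ is the cocycle generated by the equation. *)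

theory Defs
  imports "HOL-Analysis.Analysis"
begin

subsection \<open>The Hilbert space of real two-sided square-summable sequences\<close>

typedef ell2 = "{u :: int \<Rightarrow> real. (\<lambda>i. (u i)\<^sup>2) summable_on UNIV}"
  morphisms ell2_nth Abs_ell2
  by (intro exI[of _ "\<lambda>_. 0"]) simp

setup_lifting type_definition_ell2

lemma ell2_nth_summable: "(\<lambda>i. (ell2_nth u i)\<^sup>2) summable_on UNIV"
  using ell2_nth by auto

lemma square_summable_mult:
  fixes u v :: "int \<Rightarrow> real"
  assumes "(\<lambda>i. (u i)\<^sup>2) summable_on UNIV" "(\<lambda>i. (v i)\<^sup>2) summable_on UNIV"
  shows "(\<lambda>i. u i * v i) summable_on UNIV"
proof -
  have "(\<lambda>i. norm (u i * v i)) summable_on UNIV"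
  proof (rule Infinite_Sum.abs_summable_on_comparison_test')
    show "(\<lambda>i. (u i)\<^sup>2 + (v i)\<^sup>2) summable_on UNIV"
      using assms by (rule summable_on_add)
    fix i
    have "0 \<le> (\<bar>u i\<bar> - \<bar>v i\<bar>)\<^sup>2" "0 \<le> \<bar>u i\<bar> * \<bar>v i\<bar>"
      by auto
    then show "norm (u i * v i) \<le> (u i)\<^sup>2 + (v i)\<^sup>2"
      unfolding power2_diff power2_abs real_norm_def abs_mult mult.assoc by linarith
  qed
  then show ?thesis
    using summable_on_iff_abs_summable_on_real by blast
qed

lemma square_summable_add:
  fixes u v :: "int \<Rightarrow> real"
  assumes "(\<lambda>i. (u i)\<^sup>2) summable_on UNIV" "(\<lambda>i. (v i)\<^sup>2) summable_on UNIV"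
  shows "(\<lambda>i. (u i + v i)\<^sup>2) summable_on UNIV"
proof -
  have "(\<lambda>i. (u i)\<^sup>2 + (v i)\<^sup>2 + 2 * (u i * v i)) summable_on UNIV"
    by (intro summable_on_add assms summable_on_cmult_right square_summable_mult)
  then show ?thesis
    by (simp add: power2_sum mult.assoc)
qed

lemma square_summable_scale:
  fixes u :: "int \<Rightarrow> real"
  assumes "(\<lambda>i. (u i)\<^sup>2) summable_on UNIV"
  shows "(\<lambda>i. (c * u i)\<^sup>2) summable_on UNIV"
  using assms by (auto simp: power_mult_distrib intro: summable_on_cmult_right)

lemma square_summable_diff:
  fixes u v :: "int \<Rightarrow> real"
  assumes "(\<lambda>i. (u i)\<^sup>2) summable_on UNIV" "(\<lambda>i. (v i)\<^sup>2) summable_on UNIV"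
  shows "(\<lambda>i. (u i - v i)\<^sup>2) summable_on UNIV"
  using square_summable_add[OF assms(1) square_summable_scale[OF assms(2), of "-1"]] by simp

lemma square_summable_translate:
  fixes u :: "int \<Rightarrow> real"
  assumes "(\<lambda>i. (u i)\<^sup>2) summable_on UNIV"
  shows "(\<lambda>i. (u (i + c))\<^sup>2) summable_on UNIV"
proof -
  have "bij_betw (\<lambda>i::int. i + c) UNIV UNIV"
    by (intro bij_betwI[where g = "\<lambda>i. i - c"]) auto
  then show ?thesis
    using assms summable_on_reindex_bij_betw[of "\<lambda>i. i + c" UNIV UNIV "\<lambda>i. (u i)\<^sup>2"] by simp
qed

instantiation ell2 :: real_inner
begin

lift_definition zero_ell2 :: ell2 is "\<lambda>_. 0" by simp
lift_definition plus_ell2 :: "ell2 \<Rightarrow> ell2 \<Rightarrow> ell2" is "\<lambda>u v i. u i + v i"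
  by (rule square_summable_add)
lift_definition minus_ell2 :: "ell2 \<Rightarrow> ell2 \<Rightarrow> ell2" is "\<lambda>u v i. u i - v i"
  by (rule square_summable_diff)
lift_definition uminus_ell2 :: "ell2 \<Rightarrow> ell2" is "\<lambda>u i. - u i" by simp
lift_definition scaleR_ell2 :: "real \<Rightarrow> ell2 \<Rightarrow> ell2" is "\<lambda>c u i. c * u i"
  by (rule square_summable_scale)
definition inner_ell2 :: "ell2 \<Rightarrow> ell2 \<Rightarrow> real" where
  "inner_ell2 u v = (\<Sum>\<^sub>\<infinity>i. ell2_nth u i * ell2_nth v i)"
definition norm_ell2 :: "ell2 \<Rightarrow> real" where
  "norm_ell2 u = sqrt (inner u u)"
definition sgn_ell2 :: "ell2 \<Rightarrow> ell2" where
  "sgn_ell2 u = scaleR (inverse (norm u)) u"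
definition dist_ell2 :: "ell2 \<Rightarrow> ell2 \<Rightarrow> real" where
  "dist_ell2 u v = norm (u - v)"
definition uniformity_ell2 :: "(ell2 \<times> ell2) filter" where
  "uniformity_ell2 = (INF e\<in>{0 <..}. principal {(u, v). dist u v < e})"
definition open_ell2 :: "ell2 set \<Rightarrow> bool" where
  "open_ell2 U \<longleftrightarrow> (\<forall>u\<in>U. \<forall>\<^sub>F (u', v) in uniformity. u' = u \<longrightarrow> v \<in> U)"

instance
proof
  fix u v w :: ell2 and a b r :: real
  show "u + v + w = u + (v + w)" "u + v = v + u" "0 + u = u" "- u + u = 0" "u - v = u + - v"
    "a *\<^sub>R (u + v) = a *\<^sub>R u + a *\<^sub>R v" "(a + b) *\<^sub>R u = a *\<^sub>R u + b *\<^sub>R u"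
    "a *\<^sub>R b *\<^sub>R u = (a * b) *\<^sub>R u" "1 *\<^sub>R u = u"
    by (transfer; simp add: algebra_simps)+
  show "sgn u = inverse (norm u) *\<^sub>R u" "dist u v = norm (u - v)"
    "norm u = sqrt (inner u u)"
    by (simp_all add: sgn_ell2_def dist_ell2_def norm_ell2_def)
  show "uniformity = (INF e\<in>{0 <..}. principal {(u :: ell2, v). dist u v < e})"
    by (rule uniformity_ell2_def)
  show "open U \<longleftrightarrow> (\<forall>u\<in>U. \<forall>\<^sub>F (u', v) in uniformity. u' = u \<longrightarrow> v \<in> U)" for U :: "ell2 set"
    by (rule open_ell2_def)
  have summ: "(\<lambda>i. ell2_nth u i * ell2_nth v i) summable_on UNIV" for u v
    by (intro square_summable_mult ell2_nth_summable)
  show "inner u v = inner v u"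
    by (simp add: inner_ell2_def mult.commute)
  show "inner (u + v) w = inner u w + inner v w"
    unfolding inner_ell2_def plus_ell2.rep_eq distrib_right by (intro infsum_add summ)
  show "inner (r *\<^sub>R u) v = r * inner u v"
    unfolding inner_ell2_def scaleR_ell2.rep_eq mult.assoc by (intro infsum_cmult_right summ)
  show "0 \<le> inner u u"
    unfolding inner_ell2_def by (intro infsum_nonneg) simp
  show "inner u u = 0 \<longleftrightarrow> u = 0"
  proof
    assume "inner u u = 0"
    then have "ell2_nth u i * ell2_nth u i = 0" for i
      unfolding inner_ell2_def by (intro nonneg_infsum_le_0D[OF _ summ]) auto
    then have "ell2_nth u = ell2_nth 0"
      by (auto simp: zero_ell2.rep_eq)
    then show "u = 0"
      by (simp add: ell2_nth_inject)
  next
    assume "u = 0"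
    then show "inner u u = 0"
      by (simp add: inner_ell2_def zero_ell2.rep_eq)
  qed
qed

end

lemma norm_ell2_power2: "(norm (u :: ell2))\<^sup>2 = (\<Sum>\<^sub>\<infinity>i. (ell2_nth u i)\<^sup>2)"
  unfolding power2_norm_eq_inner inner_ell2_def by (simp add: power2_eq_square)

lemma sum_nth_le_norm:
  fixes u :: ell2
  assumes "finite S"
  shows "(\<Sum>i\<in>S. (ell2_nth u i)\<^sup>2) \<le> (norm u)\<^sup>2"
  unfolding norm_ell2_power2
  by (intro finite_sum_le_infsum ell2_nth_summable assms) auto

lemma abs_nth_le_norm: "\<bar>ell2_nth u i\<bar> \<le> norm u"
  using sum_nth_le_norm[of "{i}" u] by (simp add: power2_le_iff_abs_le)

instance ell2 :: banach
proof
  fix X :: "nat \<Rightarrow> ell2"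
  assume X: "Cauchy X"
  have "Cauchy (\<lambda>n. ell2_nth (X n) i)" for i
  proof (rule metric_CauchyI)
    fix e :: real
    assume "e > 0"
    then obtain N where N: "\<forall>m\<ge>N. \<forall>n\<ge>N. dist (X m) (X n) < e"
      using metric_CauchyD[OF X] by blast
    have "dist (ell2_nth (X m) i) (ell2_nth (X n) i) \<le> dist (X m) (X n)" for m n
      using abs_nth_le_norm[of "X m - X n" i] by (simp add: dist_norm minus_ell2.rep_eq)
    with N show "\<exists>N. \<forall>m\<ge>N. \<forall>n\<ge>N. dist (ell2_nth (X m) i) (ell2_nth (X n) i) < e"
      by (meson le_less_trans)
  qed
  then obtain c where c: "(\<lambda>n. ell2_nth (X n) i) \<longlonglongrightarrow> c i" for i
    unfolding Cauchy_convergent_iff convergent_def by metis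
  have tail: "\<exists>N. \<forall>n\<ge>N. \<forall>S. finite S \<longrightarrow> (\<Sum>i\<in>S. (ell2_nth (X n) i - c i)\<^sup>2) \<le> e\<^sup>2"
    if "e > 0" for e
  proof -
    obtain N where N: "\<forall>m\<ge>N. \<forall>n\<ge>N. dist (X m) (X n) < e"
      using metric_CauchyD[OF X \<open>e > 0\<close>] by blast
    have "(\<Sum>i\<in>S. (ell2_nth (X n) i - c i)\<^sup>2) \<le> e\<^sup>2" if "n \<ge> N" "finite S" for n S
    proof (rule tendsto_upperbound)
      show "(\<lambda>m. \<Sum>i\<in>S. (ell2_nth (X n) i - ell2_nth (X m) i)\<^sup>2) \<longlonglongrightarrow> (\<Sum>i\<in>S. (ell2_nth (X n) i - c i)\<^sup>2)"
        by (intro tendsto_intros c)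
      show "\<forall>\<^sub>F m in sequentially. (\<Sum>i\<in>S. (ell2_nth (X n) i - ell2_nth (X m) i)\<^sup>2) \<le> e\<^sup>2"
      proof (rule eventually_sequentiallyI[of N])
        fix m
        assume "m \<ge> N"
        then have "norm (X n - X m) \<le> e"
          using N that by (metis dist_norm less_imp_le)
        then have "(norm (X n - X m))\<^sup>2 \<le> e\<^sup>2"
          by (simp add: power_mono)
        then show "(\<Sum>i\<in>S. (ell2_nth (X n) i - ell2_nth (X m) i)\<^sup>2) \<le> e\<^sup>2"
          using sum_nth_le_norm[OF \<open>finite S\<close>, of "X n - X m"] by (simp add: minus_ell2.rep_eq)
      qed
    qed simp
    then show ?thesis
      by blast
  qed
  have summ: "(\<lambda>i. (ell2_nth (X n) i - c i)\<^sup>2) summable_on UNIV"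
    if "\<forall>S. finite S \<longrightarrow> (\<Sum>i\<in>S. (ell2_nth (X n) i - c i)\<^sup>2) \<le> e\<^sup>2" for n e
    using that by (intro nonneg_bdd_above_summable_on) (auto intro!: bdd_aboveI)
  obtain n where n: "\<forall>S. finite S \<longrightarrow> (\<Sum>i\<in>S. (ell2_nth (X n) i - c i)\<^sup>2) \<le> 1\<^sup>2"
    using tail[of 1] by auto
  have "(\<lambda>i. (c i)\<^sup>2) summable_on UNIV"
    using square_summable_diff[OF ell2_nth_summable[of "X n"] summ[OF n]] by simp
  then obtain l where l: "ell2_nth l = c"
    using Abs_ell2_inverse by auto
  have "X \<longlonglongrightarrow> l"
  proof (rule metric_LIMSEQ_I)
    fix e :: real
    assume "e > 0"
    then obtain N where N: "\<forall>n\<ge>N. \<forall>S. finite S \<longrightarrow> (\<Sum>i\<in>S. (ell2_nth (X n) i - c i)\<^sup>2) \<le> (e/2)\<^sup>2"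
      using tail[of "e/2"] by auto
    have "dist (X n) l < e" if "n \<ge> N" for n
    proof -
      have "(norm (X n - l))\<^sup>2 \<le> (e/2)\<^sup>2"
        unfolding norm_ell2_power2
        using N that ell2_nth_summable[of "X n - l"]
        by (intro infsum_le_finite_sums) (auto simp: minus_ell2.rep_eq l)
      then have "norm (X n - l) \<le> e/2"
        using \<open>e > 0\<close> by (simp add: power2_le_iff_abs_le)
      then show ?thesis
        using \<open>e > 0\<close> by (simp add: dist_norm)
    qed
    then show "\<exists>N. \<forall>n\<ge>N. dist (X n) l < e"
      by blast
  qed
  then show "convergent X"
    by (rule convergentI)
qed

subsection \<open>The operators of the lattice system\<close>

lift_definition lattice_laplacian :: "ell2 \<Rightarrow> ell2"
  is "\<lambda>u i. u (i - 1) - 2 * u i + u (i + 1)"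
proof -
  fix u :: "int \<Rightarrow> real"
  assume u: "(\<lambda>i. (u i)\<^sup>2) summable_on UNIV"
  show "(\<lambda>i. (u (i - 1) - 2 * u i + u (i + 1))\<^sup>2) summable_on UNIV"
    using square_summable_translate[OF u, of "-1"] square_summable_translate[OF u, of 1]
    by (intro square_summable_add square_summable_diff square_summable_scale u) auto
qed

text \<open>The superposition operator induced by \<open>F\<close>. Its value is unspecified if the sequence
  \<open>F (u\<^sub>i)\<close> is not square-summable; this does not happen for \<open>F 0 = 0\<close> and \<open>F\<close> Lipschitz on
  bounded sets (lemma \<open>ell2_nth_superposition\<close>).\<close>

definition superposition :: "(real \<Rightarrow> real) \<Rightarrow> ell2 \<Rightarrow> ell2" where
  "superposition F u = Abs_ell2 (\<lambda>i. F (ell2_nth u i))"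

definition lipschitz_on_bounded_sets :: "(real \<Rightarrow> real) \<Rightarrow> bool" where
  "lipschitz_on_bounded_sets F \<longleftrightarrow> (\<forall>S. bounded S \<longrightarrow> (\<exists>L. L-lipschitz_on S F))"

lemma ell2_nth_superposition:
  assumes "lipschitz_on_bounded_sets F" "F 0 = 0"
  shows "ell2_nth (superposition F u) i = F (ell2_nth u i)"
proof -
  obtain L where L: "L-lipschitz_on (cball 0 (norm u)) F"
    using assms(1) bounded_cball unfolding lipschitz_on_bounded_sets_def by blast
  have "\<bar>F (ell2_nth u i)\<bar> \<le> L * \<bar>ell2_nth u i\<bar>" for i
    using lipschitz_onD[OF L, of "ell2_nth u i" 0] abs_nth_le_norm[of u i] assms(2)
    by (simp add: dist_real_def)
  then have "(F (ell2_nth u i))\<^sup>2 \<le> (L * ell2_nth u i)\<^sup>2" for i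
    using lipschitz_on_nonneg[OF L] by (simp add: abs_le_square_iff[symmetric] abs_mult)
  then have "(\<lambda>i. (F (ell2_nth u i))\<^sup>2) summable_on UNIV"
    by (intro summable_on_comparison_test[OF square_summable_scale[OF ell2_nth_summable, of L]]) auto
  then show ?thesis
    by (simp add: superposition_def Abs_ell2_inverse)
qed

subsection \<open>Translations and hulls in the compact-open topology\<close>

text \<open>The compact-open topology on the set of all continuous functions, which is its
  \<^const>\<open>topspace\<close> (take \<open>K = {}\<close> below).\<close>

definition compact_open_topology :: "(real \<Rightarrow> 'a::topological_space) topology" where
  "compact_open_topology = topology_generated_by
     {{g. continuous_on UNIV g \<and> g ` K \<subseteq> U} | K U. compact K \<and> open U}"

definition shift :: "real \<Rightarrow> (real \<Rightarrow> 'a) \<Rightarrow> real \<Rightarrow> 'a" where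
  "shift h f = (\<lambda>t. f (t + h))"

definition hull_of :: "(real \<Rightarrow> 'a::topological_space) \<Rightarrow> (real \<Rightarrow> 'a) set" where
  "hull_of f = compact_open_topology closure_of (range (\<lambda>h. shift h f))"

text \<open>Precompact means having compact closure.\<close>

definition translation_compact :: "(real \<Rightarrow> 'a::topological_space) \<Rightarrow> bool" where
  "translation_compact f \<longleftrightarrow> continuous_on UNIV f \<and> compactin compact_open_topology (hull_of f)"

subsection \<open>The cocycle generated by the equation\<close>

text \<open>Solutions on \<open>[0, \<infinity>)\<close>, with the one-sided derivative at \<open>0\<close>; the values of \<open>u\<close> at negative
  times are irrelevant.\<close>

definition lattice_solution ::
  "real \<Rightarrow> real \<Rightarrow> (real \<Rightarrow> real) \<Rightarrow> ell2 \<Rightarrow> (real \<Rightarrow> ell2) \<Rightarrow> (real \<Rightarrow> ell2) \<Rightarrow> bool" where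
  "lattice_solution \<nu> lam F v g u \<longleftrightarrow>
     u 0 = v \<and>
     (\<forall>t\<ge>0. (u has_vector_derivative
        (\<nu> *\<^sub>R lattice_laplacian (u t) - lam *\<^sub>R u t + superposition F (u t) + g t)) (at t within {0..}))"

text \<open>The description is over the value at time \<open>t\<close>, since a solution is unique only on
  \<open>[0, \<infinity>)\<close>, not as a function on the whole line.\<close>

definition lattice_cocycle ::
  "real \<Rightarrow> real \<Rightarrow> (real \<Rightarrow> real) \<Rightarrow> real \<Rightarrow> ell2 \<Rightarrow> (real \<Rightarrow> ell2) \<Rightarrow> ell2" where
  "lattice_cocycle \<nu> lam F t v g = (THE w. \<exists>u. lattice_solution \<nu> lam F v g u \<and> u t = w)"

definition asymptotic_tails_on ::
  "(real \<Rightarrow> ell2 \<Rightarrow> 'y \<Rightarrow> ell2) \<Rightarrow> 'y set \<Rightarrow> ell2 set \<Rightarrow> bool" where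
  "asymptotic_tails_on \<phi> Y Q \<longleftrightarrow>
     (\<forall>\<epsilon>>0. \<exists>L>0. \<exists>k\<^sub>0::nat. \<forall>t\<ge>L. \<forall>v\<in>Q. \<forall>g\<in>Y.
        (\<Sum>\<^sub>\<infinity>k\<in>{k. \<bar>k\<bar> \<ge> int k\<^sub>0}. \<bar>ell2_nth (\<phi> t v g) k\<bar>\<^sup>2) < \<epsilon>)"

end

(*
  The energy of the tail is y = sum_i theta_i u_i^2 for a cutoff theta that vanishes for |i| <= K,
  equals 1 for |i| >= 2K and has increments at most 1/K. Since
  2 theta_i u_i u_(i+1) <= theta_i u_i^2 + (theta_(i+1) + 1/K) u_(i+1)^2, the Laplacian
  contributes at most |u|^2 / K to the energy balance, the nonlinearity contributes nothing
  positive, and so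
    y' <= - lam y + 2 nu |u|^2 / K + (sum_i theta_i g_i^2) / lam.
  Solutions starting in Q are bounded uniformly (the same inequality with theta = 1), and the
  values of all g in the hull lie in the compact set closure (range f), which has uniformly
  small tails; Gronwall's inequality then gives the claim.
*)

theory Submission
  imports Defs
begin

subsection \<open>Operators on \<open>\<ell>\<^sub>2\<close>\<close>

lemma summable_nth_mult: "(\<lambda>i. ell2_nth u i * ell2_nth v i) summable_on UNIV"
  by (intro square_summable_mult ell2_nth_summable)

lemma ell2_eqI: "(\<And>i. ell2_nth u i = ell2_nth v i) \<Longrightarrow> u = v"
  by (simp add: ell2_nth_inject[symmetric] fun_eq_iff)

lemma norm_ell2_leI:
  assumes "\<And>i. \<bar>ell2_nth u i\<bar> \<le> c * \<bar>ell2_nth v i\<bar>" "0 \<le> c"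
  shows "norm u \<le> c * norm v"
proof -
  have "(norm u)\<^sup>2 \<le> (\<Sum>\<^sub>\<infinity>i. c\<^sup>2 * (ell2_nth v i)\<^sup>2)"
    unfolding norm_ell2_power2
  proof (intro infsum_mono summable_on_cmult_right ell2_nth_summable)
    fix i
    show "(ell2_nth u i)\<^sup>2 \<le> c\<^sup>2 * (ell2_nth v i)\<^sup>2"
      using power_mono[OF assms(1)[of i], of 2] by (simp add: power_mult_distrib)
  qed
  also have "\<dots> = (c * norm v)\<^sup>2"
    by (simp add: infsum_cmult_right' power_mult_distrib norm_ell2_power2)
  finally show ?thesis
    using assms(2) by (simp add: power2_le_iff_abs_le)
qed

lift_definition translate :: "int \<Rightarrow> ell2 \<Rightarrow> ell2" is "\<lambda>c u i. u (i + c)"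
  by (rule square_summable_translate)

lemma infsum_translate:
  fixes f :: "int \<Rightarrow> real"
  shows "(\<Sum>\<^sub>\<infinity>i. f (i + c)) = (\<Sum>\<^sub>\<infinity>i. f i)"
proof -
  have "bij_betw (\<lambda>i::int. i + c) UNIV UNIV"
    by (intro bij_betwI[where g = "\<lambda>i. i - c"]) auto
  then show ?thesis
    by (rule infsum_reindex_bij_betw)
qed

lemma norm_translate [simp]: "norm (translate c u) = norm u"
proof -
  have "(norm (translate c u))\<^sup>2 = (norm u)\<^sup>2"
    unfolding norm_ell2_power2 translate.rep_eq
    by (rule infsum_translate[of "\<lambda>i. (ell2_nth u i)\<^sup>2"])
  then show ?thesis
    by simp
qed

text \<open>Translations are isometries, so this splitting gives the operator bound 1 + 2 + 1 = 4.
  It also lets the weighted estimate treat one neighbour at a time.\<close>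

lemma lattice_laplacian_translate:
  "lattice_laplacian u = translate (-1) u - 2 *\<^sub>R u + translate 1 u"
  by transfer simp

lemma lattice_laplacian_diff:
  "lattice_laplacian u - lattice_laplacian v = lattice_laplacian (u - v)"
  by transfer (simp add: algebra_simps)

lemma norm_lattice_laplacian_le: "norm (lattice_laplacian u) \<le> 4 * norm u"
proof -
  have "norm (lattice_laplacian u) \<le> norm (translate (-1) u) + norm (2 *\<^sub>R u) + norm (translate 1 u)"
    unfolding lattice_laplacian_translate
    by (rule order.trans[OF norm_triangle_ineq add_right_mono[OF norm_triangle_ineq4]])
  then show ?thesis
    by simp
qed

lemma lattice_laplacian_lipschitz: "4-lipschitz_on UNIV lattice_laplacian"
  by (rule lipschitz_onI)
    (auto simp: dist_norm lattice_laplacian_diff intro: norm_lattice_laplacian_le)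

lemma lipschitz_on_bounded_sets_if_lipschitz:
  "L-lipschitz_on UNIV F \<Longrightarrow> lipschitz_on_bounded_sets F"
  unfolding lipschitz_on_bounded_sets_def by (meson lipschitz_on_subset subset_UNIV)

text \<open>\<open>F\<close> acts coordinatewise, so its constant carries over to the norm. This is
  applied to the truncated nonlinearity, whose Lipschitz constant is global.\<close>

lemma superposition_lipschitz:
  assumes "L-lipschitz_on UNIV F" "F 0 = 0"
  shows "L-lipschitz_on UNIV (superposition F)"
proof (rule lipschitz_onI)
  have nth: "ell2_nth (superposition F u) i = F (ell2_nth u i)" for u i
    by (rule ell2_nth_superposition[OF lipschitz_on_bounded_sets_if_lipschitz[OF assms(1)] assms(2)])
  fix u v
  show "dist (superposition F u) (superposition F v) \<le> L * dist u v"
    unfolding dist_norm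
    using lipschitz_onD[OF assms(1)] lipschitz_on_nonneg[OF assms(1)]
    by (intro norm_ell2_leI) (auto simp: minus_ell2.rep_eq nth dist_real_def)
qed (rule lipschitz_on_nonneg[OF assms(1)])

subsection \<open>Weights\<close>

text \<open>\<open>Abs_ell2\<close> is meaningful here only if the product is square-summable, which
  the bounds in \<open>lattice_weight\<close> guarantee.\<close>

definition weighted :: "(int \<Rightarrow> real) \<Rightarrow> ell2 \<Rightarrow> ell2" where
  "weighted \<theta> u = Abs_ell2 (\<lambda>i. \<theta> i * ell2_nth u i)"

text \<open>Under these bounds \<open>inner (weighted \<theta> u) u\<close> is a positive
  semidefinite form dominated by the squared norm. The constant 1 and the cutoffs both qualify, so
  one energy estimate yields the norm bound and the tail bound.\<close>

locale lattice_weight =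
  fixes \<theta> :: "int \<Rightarrow> real"
  assumes nonneg: "0 \<le> \<theta> i" and le_1: "\<theta> i \<le> 1"
begin

lemma nth_weighted [simp]: "ell2_nth (weighted \<theta> u) i = \<theta> i * ell2_nth u i"
proof -
  have "(\<lambda>i. (\<theta> i * ell2_nth u i)\<^sup>2) summable_on UNIV"
  proof (rule summable_on_comparison_test[OF ell2_nth_summable[of u]])
    fix i
    show "(\<theta> i * ell2_nth u i)\<^sup>2 \<le> (ell2_nth u i)\<^sup>2"
      using nonneg[of i] le_1[of i]
      by (simp add: power_mult_distrib mult_left_le_one_le power_le_one)
  qed auto
  then show ?thesis
    by (simp add: weighted_def Abs_ell2_inverse)
qed

lemma bounded_linear_weighted: "bounded_linear (weighted \<theta>)"
proof (rule bounded_linear_intro)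
  fix u v :: ell2 and r :: real
  show "weighted \<theta> (u + v) = weighted \<theta> u + weighted \<theta> v"
    by (rule ell2_eqI) (simp add: plus_ell2.rep_eq algebra_simps)
  show "weighted \<theta> (r *\<^sub>R u) = r *\<^sub>R weighted \<theta> u"
    by (rule ell2_eqI) (simp add: scaleR_ell2.rep_eq)
  have "norm (weighted \<theta> u) \<le> 1 * norm u"
    using nonneg le_1 by (intro norm_ell2_leI) (auto simp: abs_mult mult_left_le_one_le)
  then show "norm (weighted \<theta> u) \<le> norm u * 1"
    by simp
qed

lemma inner_weighted: "inner (weighted \<theta> u) v = (\<Sum>\<^sub>\<infinity>i. \<theta> i * (ell2_nth u i * ell2_nth v i))"
  by (simp add: inner_ell2_def mult.assoc)

lemma summable_weighted: "(\<lambda>i. \<theta> i * (ell2_nth u i * ell2_nth v i)) summable_on UNIV"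
  using summable_nth_mult[of "weighted \<theta> u" v] by (simp add: mult.assoc)

lemma inner_weighted_commute: "inner (weighted \<theta> u) v = inner (weighted \<theta> v) u"
  by (simp add: inner_weighted mult.commute)

lemma inner_weighted_nonneg: "0 \<le> inner (weighted \<theta> u) u"
  unfolding inner_weighted using nonneg by (intro infsum_nonneg) auto

lemma inner_weighted_le: "inner (weighted \<theta> u) u \<le> (norm u)\<^sup>2"
  unfolding inner_weighted norm_ell2_power2
proof (intro infsum_mono summable_weighted ell2_nth_summable)
  fix i
  show "\<theta> i * (ell2_nth u i * ell2_nth u i) \<le> (ell2_nth u i)\<^sup>2"
    using nonneg[of i] le_1[of i] by (simp add: power2_eq_square mult_left_le_one_le)
qed

text \<open>Expand the nonnegative form at \<open>c *\<^sub>R u - v\<close>, use its symmetry, and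
  divide by \<open>c\<close>.\<close>

lemma inner_weighted_young:
  assumes "c > 0"
  shows "2 * inner (weighted \<theta> u) v \<le> c * inner (weighted \<theta> u) u + inner (weighted \<theta> v) v / c"
proof -
  have "0 \<le> inner (weighted \<theta> (c *\<^sub>R u - v)) (c *\<^sub>R u - v)"
    by (rule inner_weighted_nonneg)
  also have "\<dots> = c * (c * inner (weighted \<theta> u) u) - 2 * (c * inner (weighted \<theta> u) v)
      + inner (weighted \<theta> v) v"
    using inner_weighted_commute[of u v]
    by (simp add: bounded_linear.linear[OF bounded_linear_weighted] linear_diff linear_scale
        inner_diff inner_commute algebra_simps)
  finally have "2 * inner (weighted \<theta> u) v * c
      \<le> (c * inner (weighted \<theta> u) u + inner (weighted \<theta> v) v / c) * c"
    using assms by (simp add: algebra_simps)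
  then show ?thesis
    using assms by simp
qed

section \<open>Energy estimates for the terms of the equation\<close>

lemma inner_weighted_superposition_nonpos:
  assumes "\<And>u i. ell2_nth (superposition F u) i = F (ell2_nth u i)" "\<And>s. s * F s \<le> 0"
  shows "inner (weighted \<theta> u) (superposition F u) \<le> 0"
proof -
  have "(\<Sum>\<^sub>\<infinity>i. \<theta> i * (ell2_nth u i * ell2_nth (superposition F u) i)) \<le> (\<Sum>\<^sub>\<infinity>i::int. 0)"
    using nonneg assms(2)
    by (intro infsum_mono summable_weighted) (auto simp: assms(1) mult_nonneg_nonpos)
  then show ?thesis
    by (simp add: inner_weighted)
qed

text \<open>Young's inequality with c = 1 splits the cross term into the energies of
  \<open>u\<close> and of its translate. Reindexing moves the translation onto the weight, where
  slow variation costs \<delta> times the squared norm.\<close>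

lemma inner_weighted_translate_le:
  assumes "\<And>i. \<theta> (i - c) \<le> \<theta> i + \<delta>"
  shows "2 * inner (weighted \<theta> u) (translate c u) \<le> 2 * inner (weighted \<theta> u) u + \<delta> * (norm u)\<^sup>2"
proof -
  have "inner (weighted \<theta> (translate c u)) (translate c u)
      = (\<Sum>\<^sub>\<infinity>i. \<theta> (i - c) * (ell2_nth u i * ell2_nth u i))"
    using infsum_translate[of "\<lambda>i. \<theta> (i - c) * (ell2_nth u i * ell2_nth u i)" c]
    by (simp add: inner_weighted translate.rep_eq)
  also have "\<dots> \<le> (\<Sum>\<^sub>\<infinity>i. \<theta> i * (ell2_nth u i * ell2_nth u i) + \<delta> * (ell2_nth u i)\<^sup>2)"
  proof (intro infsum_mono summable_on_add summable_weighted summable_on_cmult_right ell2_nth_summable)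
    \<comment> \<open>The translated weight is again a weight, which supplies the summability of the
      reindexed series.\<close>
    interpret shifted: lattice_weight "\<lambda>i. \<theta> (i - c)"
      by unfold_locales (auto simp: nonneg le_1)
    show "(\<lambda>i. \<theta> (i - c) * (ell2_nth u i * ell2_nth u i)) summable_on UNIV"
      by (rule shifted.summable_weighted)
    fix i
    show "\<theta> (i - c) * (ell2_nth u i * ell2_nth u i)
        \<le> \<theta> i * (ell2_nth u i * ell2_nth u i) + \<delta> * (ell2_nth u i)\<^sup>2"
      using mult_right_mono[OF assms[of i], of "ell2_nth u i * ell2_nth u i"]
      by (simp add: algebra_simps power2_eq_square)
  qed
  also have "\<dots> = inner (weighted \<theta> u) u + \<delta> * (norm u)\<^sup>2"
    unfolding inner_weighted norm_ell2_power2
    by (subst infsum_add) (auto intro!: summable_weighted summable_on_cmult_right ell2_nth_summable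
        simp: infsum_cmult_right')
  finally show ?thesis
    using inner_weighted_young[of 1 u "translate c u"] by simp
qed

text \<open>The central term \<open>- 2 *\<^sub>R u\<close> cancels the energies produced by the two
  neighbours; only the two \<delta> errors survive.\<close>

lemma inner_weighted_laplacian_le:
  assumes "\<And>i. \<theta> (i + 1) \<le> \<theta> i + \<delta>" "\<And>i. \<theta> i \<le> \<theta> (i + 1) + \<delta>"
  shows "inner (weighted \<theta> u) (lattice_laplacian u) \<le> \<delta> * (norm u)\<^sup>2"
  using inner_weighted_translate_le[of 1 \<delta> u] inner_weighted_translate_le[of "-1" \<delta> u]
    assms(1) assms(2)[of "_ - 1"]
  by (simp add: lattice_laplacian_translate inner_diff_right inner_add_right)

lemma inner_weighted_has_derivative:
  assumes "(u has_vector_derivative u') (at t within S)"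
  shows "((\<lambda>t. inner (weighted \<theta> (u t)) (u t)) has_real_derivative
    2 * inner (weighted \<theta> (u t)) u') (at t within S)"
proof -
  have "((\<lambda>t. inner (weighted \<theta> (u t)) (u t)) has_vector_derivative
      inner (weighted \<theta> (u t)) u' + inner (weighted \<theta> u') (u t)) (at t within S)"
    by (intro bounded_bilinear.has_vector_derivative[OF bounded_bilinear_inner]
        bounded_linear.has_vector_derivative[OF bounded_linear_weighted] assms)
  then show ?thesis
    using inner_weighted_commute[of u' "u t"]
    by (simp add: has_real_derivative_iff_has_vector_derivative)
qed

text \<open>The damping contributes -2 \<open>lam\<close> times the energy. Young's inequality with
  c = \<open>lam\<close> spends half of it on absorbing the forcing.\<close>

lemma lattice_energy_inequality:
  assumes "0 < \<nu>" "0 < lam"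
    and "\<And>u i. ell2_nth (superposition F u) i = F (ell2_nth u i)" "\<And>s. s * F s \<le> 0"
    and "\<And>i. \<theta> (i + 1) \<le> \<theta> i + \<delta>" "\<And>i. \<theta> i \<le> \<theta> (i + 1) + \<delta>"
  shows "2 * inner (weighted \<theta> u) (\<nu> *\<^sub>R lattice_laplacian u - lam *\<^sub>R u + superposition F u + g)
    \<le> - lam * inner (weighted \<theta> u) u + (2 * \<nu> * \<delta> * (norm u)\<^sup>2 + inner (weighted \<theta> g) g / lam)"
proof -
  have "\<nu> * inner (weighted \<theta> u) (lattice_laplacian u) \<le> \<nu> * (\<delta> * (norm u)\<^sup>2)"
    using assms(1) by (intro mult_left_mono inner_weighted_laplacian_le assms) auto
  then show ?thesis
    using inner_weighted_superposition_nonpos[OF assms(3,4), of u]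
      inner_weighted_young[OF assms(2), of u g]
    by (simp add: inner_add_right inner_diff_right algebra_simps)
qed

end

subsection \<open>Ordinary differential equations\<close>

text \<open>Gronwall's inequality via the integrating factor \<open>exp (a * t)\<close>. The sign of
  \<open>a\<close> is left open: it is positive for the energy decay and negative for
  uniqueness.\<close>

lemma linear_differential_inequality:
  fixes y :: "real \<Rightarrow> real"
  assumes deriv: "\<And>t. 0 \<le> t \<Longrightarrow> (y has_real_derivative y' t) (at t within {0..})"
    and le: "\<And>t. 0 \<le> t \<Longrightarrow> y' t \<le> - a * y t + b"
    and "a \<noteq> 0" "0 \<le> t"
  shows "y t \<le> exp (- a * t) * (y 0 - b / a) + b / a"
proof -
  define z where "z = (\<lambda>t. exp (a * t) * (y t - b / a))"
  have z: "(z has_real_derivative exp (a * s) * (y' s + a * y s - b)) (at s within {0..})" if "0 \<le> s" for s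
    unfolding z_def using \<open>a \<noteq> 0\<close>
    by (auto intro!: derivative_eq_intros deriv that simp: field_simps)
  \<comment> \<open>The monotonicity criterion asks for derivatives only inside the interval, so the
    one-sided derivative at 0 enters through continuity alone.\<close>
  have "z t \<le> z 0"
  proof (rule DERIV_nonpos_imp_decreasing_open[OF \<open>0 \<le> t\<close>])
    fix s
    assume s: "0 < s" "s < t"
    have "at s within {0..} = at s"
      using s by (intro at_within_interior) (auto simp: interior_real_atLeast)
    moreover have "exp (a * s) * (y' s + a * y s - b) \<le> 0"
      using le[of s] s by (intro mult_nonneg_nonpos) auto
    ultimately show "\<exists>d. (z has_real_derivative d) (at s) \<and> d \<le> 0"
      using z[of s] s by auto
  next
    have "continuous_on {0..} z"
      using z by (intro DERIV_continuous_on[of _ z]) auto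
    then show "continuous_on {0..t} z"
      by (rule continuous_on_subset) auto
  qed
  then have "exp (- (a * t)) * (exp (a * t) * (y t - b / a)) \<le> exp (- (a * t)) * (y 0 - b / a)"
    by (simp add: z_def)
  then show ?thesis
    by (simp add: mult.assoc[symmetric] exp_add[symmetric])
qed

section \<open>Picard iteration on the half-line, and uniqueness\<close>

text \<open>Integrating the exponential bound gains the factor 1 / a, which makes the Picard
  operator contract in the exponentially weighted norm.\<close>

lemma norm_integral_le_exp:
  fixes h :: "real \<Rightarrow> 'a::banach"
  assumes "continuous_on {0..s} h" "\<And>r. 0 \<le> r \<Longrightarrow> norm (h r) \<le> c * exp (a * r)"
    and "0 < a" "0 \<le> s"
  shows "norm (integral {0..s} h) \<le> c / a * (exp (a * s) - 1)"
proof -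
  have "((\<lambda>r. c / a * exp (a * r)) has_vector_derivative c * exp (a * r)) (at r within {0..s})" for r
    unfolding has_real_derivative_iff_has_vector_derivative[symmetric]
    using \<open>0 < a\<close> by (auto intro!: derivative_eq_intros)
  then have "((\<lambda>r. c * exp (a * r)) has_integral c / a * exp (a * s) - c / a * exp (a * 0)) {0..s}"
    using \<open>0 \<le> s\<close> by (intro fundamental_theorem_of_calculus)
  moreover have "h integrable_on {0..s}"
    by (intro integrable_continuous_real assms)
  ultimately show ?thesis
    using integral_norm_bound_integral[of h "{0..s}" "\<lambda>r. c * exp (a * r)"] assms(2)
    by (auto simp: has_integral_iff right_diff_distrib)
qed

lemma integral_has_vector_derivative_atLeast:
  fixes h :: "real \<Rightarrow> 'a::banach"
  assumes "continuous_on {a..} h" "a \<le> t"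
  shows "((\<lambda>s. integral {a..s} h) has_vector_derivative h t) (at t within {a..})"
proof -
  have "((\<lambda>s. integral {a..s} h) has_vector_derivative h t) (at t within {a..t + 1})"
    using assms by (intro integral_has_vector_derivative continuous_on_subset[OF assms(1)]) auto
  moreover have "at t within {a..t + 1} = at t within {a..}"
    by (rule at_within_nhd[of _ "{..<t + 1}"]) auto
  ultimately show ?thesis
    by simp
qed

text \<open>The Picard operator is a contraction of the functions \<open>w t = exp (- 2 K t) u t\<close>, which
  yields a solution on the whole half-line at once.\<close>

lemma lipschitz_ode_solution_exists:
  fixes G :: "'a::banach \<Rightarrow> 'a"
  assumes lip: "K-lipschitz_on UNIV G"
    and g: "continuous_on UNIV g" "\<And>t. norm (g t) \<le> M"
  obtains u where "u 0 = v"
    "\<And>t. 0 \<le> t \<Longrightarrow> (u has_vector_derivative G (u t) + g t) (at t within {0..})"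
proof -
  \<comment> \<open>The rate is chosen so that the contraction factor K / A is at most 1/2; the
    summand 1 keeps \<open>A\<close> positive when K = 0.\<close>
  define A where "A = 2 * K + 1"
  have K: "0 \<le> K"
    by (rule lipschitz_on_nonneg[OF lip])
  have A: "0 < A" and KA: "K / A \<le> 1 / 2"
    using K by (auto simp: A_def divide_simps)
  \<comment> \<open>\<open>H w\<close> is the right-hand side along
    \<open>exp (A * r) *\<^sub>R w r\<close>, and \<open>P w\<close> is the rescaled integral
    equation. \<open>max 0 t\<close> extends \<open>P w\<close> by the constant \<open>v\<close> to
    negative times, since bounded continuous functions live on the whole line.\<close>
  define H where "H = (\<lambda>(w :: real \<Rightarrow>\<^sub>C 'a) r. G (exp (A * r) *\<^sub>R w r) + g r)"
  define P where "P = (\<lambda>w t. exp (- A * max 0 t) *\<^sub>R (v + integral {0..max 0 t} (H w)))"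
  have H_cont: "continuous_on S (H w)" for S w
    unfolding H_def
    by (intro continuous_on_add continuous_on_compose2[OF lipschitz_on_continuous_on[OF lip]]
        continuous_intros continuous_on_subset[OF g(1)] continuous_on_subset[OF continuous_on_apply_bcontfun]) auto
  have H_int: "((\<lambda>s. integral {0..s} (H w)) has_vector_derivative H w t) (at t within {0..})"
    if "0 \<le> t" for w t
    using that by (intro integral_has_vector_derivative_atLeast H_cont)
  have P_cont: "continuous_on UNIV (P w)" for w
  proof -
    have "continuous_on {0..} (\<lambda>s. integral {0..s} (H w))"
      unfolding continuous_on_eq_continuous_within
      using H_int has_vector_derivative_continuous by (metis atLeast_iff)
    then have "continuous_on UNIV (\<lambda>t. integral {0..max 0 t} (H w))"
      by (rule continuous_on_compose2) (auto intro!: continuous_intros)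
    then show ?thesis
      unfolding P_def by (intro continuous_intros)
  qed
  \<comment> \<open>\<open>H w\<close> grows at most like \<open>exp (A * r)\<close>, so the factor
    \<open>exp (- A * t)\<close> in \<open>P\<close> compensates the growth of its integral.\<close>
  have P_bounded: "bounded (range (P w))" for w
  proof -
    define c where "c = K * norm w + norm (G 0) + M"
    have M: "0 \<le> M"
      using g(2)[of 0] norm_ge_zero order.trans by blast
    have c: "0 \<le> c"
      using K M by (simp add: c_def)
    have H_le: "norm (H w r) \<le> c * exp (A * r)" if "0 \<le> r" for r
    proof -
      have 1: "1 \<le> exp (A * r)"
        using A that by simp
      have "norm (H w r) \<le> norm (G (exp (A * r) *\<^sub>R w r) - G 0) + norm (G 0) + norm (g r)"
        unfolding H_def using norm_triangle_ineq[of "G (exp (A * r) *\<^sub>R w r)" "g r"]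
          norm_triangle_sub[of "G (exp (A * r) *\<^sub>R w r)" "G 0"] by linarith
      also have "\<dots> \<le> K * (exp (A * r) * norm w) + norm (G 0) + M"
      proof (intro add_mono g(2) order.refl)
        have "norm (G (exp (A * r) *\<^sub>R w r) - G 0) \<le> K * (exp (A * r) * norm (w r))"
          using lipschitz_onD[OF lip, of "exp (A * r) *\<^sub>R w r" 0] by (simp add: dist_norm)
        also have "\<dots> \<le> K * (exp (A * r) * norm w)"
          using K norm_bounded[of w r] by (intro mult_left_mono) auto
        finally show "norm (G (exp (A * r) *\<^sub>R w r) - G 0) \<le> K * (exp (A * r) * norm w)" .
      qed
      also have "\<dots> \<le> c * exp (A * r)"
        using mult_left_mono[OF 1, of "norm (G 0) + M"] M
        by (simp add: c_def algebra_simps)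
      finally show ?thesis .
    qed
    have "norm (P w t) \<le> norm v + c / A" for t
    proof -
      define s where "s = max 0 t"
      have s: "0 \<le> s"
        by (simp add: s_def)
      have "norm (integral {0..s} (H w)) \<le> c / A * (exp (A * s) - 1)"
        using A s by (intro norm_integral_le_exp H_cont H_le)
      then have "norm (v + integral {0..s} (H w)) \<le> norm v + c / A * (exp (A * s) - 1)"
        using norm_triangle_ineq[of v "integral {0..s} (H w)"] by linarith
      also have "\<dots> \<le> exp (A * s) * (norm v + c / A)"
        using mult_right_mono[of 1 "exp (A * s)" "norm v"] divide_nonneg_pos[OF c A(1)] A s
        by (simp add: algebra_simps)
      finally have "exp (- A * s) * norm (v + integral {0..s} (H w))
          \<le> exp (- A * s) * (exp (A * s) * (norm v + c / A))"
        by (intro mult_left_mono) auto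
      then show ?thesis
        by (simp add: P_def s_def[symmetric] mult.assoc[symmetric] exp_add[symmetric])
    qed
    then show ?thesis
      by (auto simp: bounded_iff)
  qed
  have P_bcontfun: "apply_bcontfun (Bcontfun (P w)) = P w" for w
    using P_cont P_bounded by (intro Bcontfun_inverse) (simp add: bcontfun_def)
  \<comment> \<open>The forcing cancels in \<open>H w - H w'\<close>; what remains is at most
    \<open>K * dist w w' * exp (A * r)\<close>, and integration gains 1 / A.\<close>
  have contraction: "dist (Bcontfun (P w)) (Bcontfun (P w')) \<le> 1 / 2 * dist w w'" for w w'
  proof (rule dist_bound)
    fix t :: real
    define s where "s = max 0 t"
    have s: "0 \<le> s"
      by (simp add: s_def)
    have "norm (integral {0..s} (\<lambda>r. H w r - H w' r)) \<le> K * dist w w' / A * (exp (A * s) - 1)"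
    proof (intro norm_integral_le_exp[OF _ _ A s] continuous_on_diff H_cont)
      fix r :: real
      have "norm (H w r - H w' r) \<le> K * (exp (A * r) * dist (w r) (w' r))"
        using lipschitz_onD[OF lip, of "exp (A * r) *\<^sub>R w r" "exp (A * r) *\<^sub>R w' r"]
        by (simp add: H_def dist_norm scaleR_diff_right[symmetric])
      also have "\<dots> \<le> K * (exp (A * r) * dist w w')"
        using K dist_bounded[of w r w'] by (intro mult_left_mono) auto
      finally show "norm (H w r - H w' r) \<le> K * dist w w' * exp (A * r)"
        by (simp add: mult_ac)
    qed
    also have "\<dots> \<le> K / A * dist w w' * exp (A * s)"
      using K A by (simp add: right_diff_distrib)
    also have "\<dots> \<le> 1 / 2 * dist w w' * exp (A * s)"
      using KA by (intro mult_right_mono) auto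
    finally have "exp (- A * s) * norm (integral {0..s} (\<lambda>r. H w r - H w' r))
        \<le> exp (- A * s) * (1 / 2 * dist w w' * exp (A * s))"
      by (intro mult_left_mono) auto
    also have "\<dots> = exp (- A * s) * exp (A * s) * (1 / 2 * dist w w')"
      by (simp only: mult_ac)
    also have "\<dots> = 1 / 2 * dist w w'"
      by (simp add: exp_add[symmetric])
    also have "integral {0..s} (\<lambda>r. H w r - H w' r) = integral {0..s} (H w) - integral {0..s} (H w')"
      by (intro integral_diff integrable_continuous_real H_cont)
    finally show "dist (apply_bcontfun (Bcontfun (P w)) t) (apply_bcontfun (Bcontfun (P w')) t)
        \<le> 1 / 2 * dist w w'"
      unfolding P_bcontfun
      by (simp add: P_def s_def[symmetric] dist_norm scaleR_diff_right[symmetric])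
  qed
  obtain w where w: "Bcontfun (P w) = w"
    using banach_fix_type[of "1 / 2" "\<lambda>w. Bcontfun (P w)"] contraction by auto
  \<comment> \<open>Defining \<open>u\<close> by the integral makes its derivative immediate;
    \<open>u_w\<close> then identifies it with the rescaled fixed point, which turns
    \<open>H w\<close> into the right-hand side at \<open>u\<close>.\<close>
  define u where "u = (\<lambda>t. v + integral {0..t} (H w))"
  have u_w: "exp (A * t) *\<^sub>R w t = u t" if "0 \<le> t" for t
  proof -
    have "w t = P w t"
      by (metis P_bcontfun w)
    then show ?thesis
      using that by (simp add: P_def u_def mult.assoc[symmetric] exp_add[symmetric])
  qed
  show thesis
  proof
    show "u 0 = v"
      by (simp add: u_def)
    fix t :: real
    assume t: "0 \<le> t"
    have "(u has_vector_derivative 0 + H w t) (at t within {0..})"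
      unfolding u_def using t by (intro has_vector_derivative_add has_vector_derivative_const H_int)
    then show "(u has_vector_derivative G (u t) + g t) (at t within {0..})"
      using u_w[OF t] by (simp add: H_def)
  qed
qed

text \<open>The squared norm of the difference has derivative at most 2 K times itself and vanishes
  at 0. Gronwall is applied with rate -(2 K + 1), which is nonzero even when K = 0.\<close>

lemma lipschitz_ode_solution_unique:
  fixes G :: "'a::real_inner \<Rightarrow> 'a"
  assumes lip: "K-lipschitz_on UNIV G"
    and u: "\<And>t. 0 \<le> t \<Longrightarrow> (u has_vector_derivative G (u t) + g t) (at t within {0..})"
    and w: "\<And>t. 0 \<le> t \<Longrightarrow> (w has_vector_derivative G (w t) + g t) (at t within {0..})"
    and "u 0 = w 0" "0 \<le> t"
  shows "u t = w t"
proof -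
  define d where "d = (\<lambda>t. u t - w t)"
  have "inner (d t) (d t) \<le> exp (- (- (2 * K + 1)) * t) * (inner (d 0) (d 0) - 0 / - (2 * K + 1)) + 0 / - (2 * K + 1)"
  proof (rule linear_differential_inequality)
    fix s :: real
    assume s: "0 \<le> s"
    have "(d has_vector_derivative G (u s) + g s - (G (w s) + g s)) (at s within {0..})"
      unfolding d_def by (intro has_vector_derivative_diff u w s)
    then have "(d has_vector_derivative G (u s) - G (w s)) (at s within {0..})"
      by simp
    from bounded_bilinear.has_vector_derivative[OF bounded_bilinear_inner this this]
    show "((\<lambda>s. inner (d s) (d s)) has_real_derivative 2 * inner (d s) (G (u s) - G (w s)))
        (at s within {0..})"
      by (simp add: has_real_derivative_iff_has_vector_derivative inner_commute)
    have "inner (d s) (G (u s) - G (w s)) \<le> norm (d s) * (K * norm (d s))"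
      using lipschitz_onD[OF lip, of "u s" "w s"]
      by (intro order.trans[OF norm_cauchy_schwarz] mult_left_mono) (auto simp: d_def dist_norm)
    then have "2 * inner (d s) (G (u s) - G (w s)) \<le> 2 * (norm (d s) * (K * norm (d s)))"
      by simp
    also have "\<dots> \<le> - (- (2 * K + 1)) * inner (d s) (d s) + 0"
      by (simp add: dot_square_norm power2_eq_square algebra_simps)
    finally show "2 * inner (d s) (G (u s) - G (w s)) \<le> - (- (2 * K + 1)) * inner (d s) (d s) + 0" .
  qed (use lipschitz_on_nonneg[OF lip] \<open>0 \<le> t\<close> in auto)
  then have "inner (d t) (d t) \<le> 0"
    using \<open>u 0 = w 0\<close> by (simp add: d_def)
  then have "d t = 0"
    by (meson inner_eq_zero_iff inner_ge_zero order.antisym)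
  then show ?thesis
    by (simp add: d_def)
qed

subsection \<open>Existence and uniqueness for the lattice system\<close>

text \<open>Coordinates are bounded by the norm, so on a ball \<open>F\<close> enters only through
  its values on an interval. This is what justifies truncation.\<close>

lemma superposition_cong:
  assumes "\<And>s. \<bar>s\<bar> \<le> norm u \<Longrightarrow> F s = F' s"
  shows "superposition F u = superposition F' u"
  by (simp add: superposition_def assms[OF abs_nth_le_norm])

lemma lattice_solution_cong:
  assumes "\<And>s. \<bar>s\<bar> \<le> R \<Longrightarrow> F s = F' s" "\<And>t. 0 \<le> t \<Longrightarrow> norm (u t) \<le> R"
  shows "lattice_solution \<nu> lam F v g u \<longleftrightarrow> lattice_solution \<nu> lam F' v g u"
proof -
  have "superposition F (u t) = superposition F' (u t)" if "0 \<le> t" for t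
    using assms(1) assms(2)[OF that] by (intro superposition_cong) auto
  then show ?thesis
    by (simp add: lattice_solution_def)
qed

text \<open>Gronwall with rate \<open>lam\<close> applied to the weighted energy: \<beta> bounds the
  cost of the varying weight along the solution, \<eta> the weighted forcing.\<close>

lemma lattice_solution_weighted_le:
  assumes "lattice_weight \<theta>"
    and "0 < \<nu>" "0 < lam"
    and "lipschitz_on_bounded_sets F" "F 0 = 0" "\<And>s. s * F s \<le> 0"
    and "lattice_solution \<nu> lam F v g u"
    and "\<And>i. \<theta> (i + 1) \<le> \<theta> i + \<delta>" "\<And>i. \<theta> i \<le> \<theta> (i + 1) + \<delta>"
    and "\<And>t. 0 \<le> t \<Longrightarrow> 2 * \<nu> * \<delta> * (norm (u t))\<^sup>2 \<le> \<beta>"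
    and "\<And>t. inner (weighted \<theta> (g t)) (g t) \<le> \<eta>"
    and "0 \<le> t"
  shows "inner (weighted \<theta> (u t)) (u t) \<le> exp (- lam * t) * (norm v)\<^sup>2 + (\<beta> + \<eta> / lam) / lam"
proof -
  interpret lattice_weight \<theta> by fact
  have u0: "u 0 = v"
    and deriv: "\<And>t. 0 \<le> t \<Longrightarrow> (u has_vector_derivative (\<nu> *\<^sub>R lattice_laplacian (u t) - lam *\<^sub>R u t
      + superposition F (u t) + g t)) (at t within {0..})"
    using assms(7) by (auto simp: lattice_solution_def)
  have nth: "ell2_nth (superposition F u) i = F (ell2_nth u i)" for u i
    by (intro ell2_nth_superposition assms)
  have "0 \<le> inner (weighted \<theta> (g 0)) (g 0)"
    by (rule inner_weighted_nonneg)
  then have "0 \<le> \<eta>"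
    using assms(11) order.trans by blast
  have "0 \<le> \<beta>"
  proof -
    have "0 \<le> \<delta>"
      using assms(8)[of 0] assms(9)[of 0] by linarith
    then have "0 \<le> 2 * \<nu> * \<delta> * (norm (u 0))\<^sup>2"
      using assms(2) by simp
    then show ?thesis
      using assms(10)[of 0] by linarith
  qed
  have "inner (weighted \<theta> (u t)) (u t) \<le> exp (- lam * t) *
      (inner (weighted \<theta> (u 0)) (u 0) - (\<beta> + \<eta> / lam) / lam) + (\<beta> + \<eta> / lam) / lam"
  proof (rule linear_differential_inequality[OF inner_weighted_has_derivative[OF deriv]])
    fix s :: real
    assume "0 \<le> s"
    then have "2 * \<nu> * \<delta> * (norm (u s))\<^sup>2 + inner (weighted \<theta> (g s)) (g s) / lam \<le> \<beta> + \<eta> / lam"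
      using assms(3) by (intro add_mono divide_right_mono assms) auto
    then show "2 * inner (weighted \<theta> (u s)) (\<nu> *\<^sub>R lattice_laplacian (u s) - lam *\<^sub>R u s
        + superposition F (u s) + g s) \<le> - lam * inner (weighted \<theta> (u s)) (u s) + (\<beta> + \<eta> / lam)"
      using lattice_energy_inequality[where u = "u s" and g = "g s", OF assms(2,3) nth assms(6,8,9)]
      by linarith
  qed (use assms(3,12) in auto)
  also have "\<dots> \<le> exp (- lam * t) * (norm v)\<^sup>2 + (\<beta> + \<eta> / lam) / lam"
    using inner_weighted_le[of v] \<open>0 \<le> \<beta>\<close> \<open>0 \<le> \<eta>\<close> assms(3)
    by (intro add_right_mono mult_left_mono) (auto simp: u0 intro: order.trans[rotated])
  finally show ?thesis .
qed

text \<open>The weighted bound for the constant weight 1, where \<delta> = 0 and hence \<beta> =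
  0.\<close>

lemma lattice_solution_bounded:
  assumes "0 < \<nu>" "0 < lam"
    and "lipschitz_on_bounded_sets F" "F 0 = 0" "\<And>s. s * F s \<le> 0"
    and "lattice_solution \<nu> lam F v g u"
    and "\<And>t. norm (g t) \<le> M" "0 \<le> t"
  shows "(norm (u t))\<^sup>2 \<le> (norm v)\<^sup>2 + M\<^sup>2 / lam\<^sup>2"
proof -
  interpret one: lattice_weight "\<lambda>_. 1"
    by unfold_locales auto
  have one [simp]: "weighted (\<lambda>_. 1) w = w" for w
    by (rule ell2_eqI) simp
  have "inner (weighted (\<lambda>_. 1) (u t)) (u t) \<le> exp (- lam * t) * (norm v)\<^sup>2 + (0 + M\<^sup>2 / lam) / lam"
    using assms by (intro lattice_solution_weighted_le[OF one.lattice_weight_axioms, where \<delta> = 0])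
      (auto simp: dot_square_norm power_mono)
  also have "exp (- lam * t) * (norm v)\<^sup>2 \<le> 1 * (norm v)\<^sup>2"
    using assms by (intro mult_right_mono) auto
  finally show ?thesis
    by (simp add: dot_square_norm power2_eq_square)
qed

text \<open>Every solution stays in a ball, so \<open>F\<close> may be replaced by its truncation, which turns
  the right-hand side into a globally Lipschitz one.\<close>

lemma lattice_solution_exists_unique:
  assumes "0 < \<nu>" "0 < lam"
    and F: "lipschitz_on_bounded_sets F" "F 0 = 0" "\<And>s. s * F s \<le> 0"
    and g: "continuous_on UNIV g" "\<And>t. norm (g t) \<le> M"
  shows "\<exists>u. lattice_solution \<nu> lam F v g u \<and>
    (\<forall>w t. lattice_solution \<nu> lam F v g w \<longrightarrow> 0 \<le> t \<longrightarrow> w t = u t)"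
proof -
  \<comment> \<open>\<open>R\<close> is the a priori bound of
    \<open>lattice_solution_bounded\<close>. \<open>T\<close> composes \<open>F\<close> with the
    projection onto [-R, R], so the Lipschitz constant of \<open>F\<close> on this interval becomes
    global.\<close>
  define R where "R = sqrt ((norm v)\<^sup>2 + M\<^sup>2 / lam\<^sup>2)"
  define T where "T = (\<lambda>s. F (max (- R) (min R s)))"
  have R: "0 \<le> R"
    by (simp add: R_def)
  obtain L where "L-lipschitz_on {-R..R} F"
    using F(1) bounded_closed_interval unfolding lipschitz_on_bounded_sets_def by blast
  have T_lip: "L-lipschitz_on UNIV T"
  proof (rule lipschitz_onI)
    show L: "0 \<le> L"
      by (rule lipschitz_on_nonneg) fact
    fix r s :: real
    have "dist (T r) (T s) \<le> L * dist (max (- R) (min R r)) (max (- R) (min R s))"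
      unfolding T_def using R by (intro lipschitz_onD[OF \<open>L-lipschitz_on {-R..R} F\<close>]) auto
    also have "\<dots> \<le> L * dist r s"
      using L by (intro mult_left_mono) (auto simp: dist_real_def max_def min_def)
    finally show "dist (T r) (T s) \<le> L * dist r s" .
  qed
  have T_0: "T 0 = 0"
    using R F(2) by (simp add: T_def)
  \<comment> \<open>Clipping never reverses the sign of \<open>s\<close>, so the a priori bound
    holds for the truncated equation as well.\<close>
  have T_sign: "s * T s \<le> 0" for s
    using F(3)[of "max (- R) (min R s)"] R F(2)
    by (auto simp: T_def max_def min_def mult_le_0_iff split: if_splits)
  have T_eq: "F s = T s" if "\<bar>s\<bar> \<le> R" for s
    using that by (auto simp: T_def max_def min_def)
  define G where "G = (\<lambda>u. \<nu> *\<^sub>R lattice_laplacian u - lam *\<^sub>R u + superposition T u)"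
  have G_lip: "(\<bar>\<nu>\<bar> * 4 + \<bar>lam\<bar> * 1 + L)-lipschitz_on UNIV G"
    unfolding G_def by (intro lipschitz_intros lattice_laplacian_lipschitz superposition_lipschitz T_lip T_0)
  \<comment> \<open>Solutions of both equations stay in the ball where \<open>F\<close> and
    \<open>T\<close> agree, so existence and uniqueness transfer from \<open>T\<close> to
    \<open>F\<close>.\<close>
  have bounded: "norm (u t) \<le> R"
    if "lattice_solution \<nu> lam F' v g u" "F' \<in> {F, T}" "0 \<le> t" for F' u t
    unfolding R_def
    using that assms T_0 T_sign lipschitz_on_bounded_sets_if_lipschitz[OF T_lip]
    by (intro real_le_rsqrt lattice_solution_bounded[of \<nu> lam F']) auto
  have T_solution: "lattice_solution \<nu> lam T v g u \<longleftrightarrow> u 0 = v \<and>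
      (\<forall>t\<ge>0. (u has_vector_derivative G (u t) + g t) (at t within {0..}))" for u
    by (simp add: lattice_solution_def G_def)
  obtain u where u: "lattice_solution \<nu> lam T v g u"
    unfolding T_solution using lipschitz_ode_solution_exists[OF G_lip g] by metis
  show ?thesis
  proof (intro exI[of _ u] conjI allI impI)
    show "lattice_solution \<nu> lam F v g u"
      using u bounded[OF u] lattice_solution_cong[of R F T u] T_eq by auto
    fix w and t :: real
    assume w: "lattice_solution \<nu> lam F v g w" and t: "0 \<le> t"
    have "lattice_solution \<nu> lam T v g w"
      using w bounded[OF w] lattice_solution_cong[of R F T w] T_eq by auto
    with u have "w 0 = u 0"
      and "\<And>t. 0 \<le> t \<Longrightarrow> (w has_vector_derivative G (w t) + g t) (at t within {0..})"
      and "\<And>t. 0 \<le> t \<Longrightarrow> (u has_vector_derivative G (u t) + g t) (at t within {0..})"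
      unfolding T_solution by simp_all
    then show "w t = u t"
      using lipschitz_ode_solution_unique[OF G_lip, of w g u t] t by blast
  qed
qed

text \<open>Uniqueness makes the definite description well defined at each time, and one solution
  \<open>u\<close> serves all times at once.\<close>

lemma lattice_cocycle_eq_solution:
  assumes "0 < \<nu>" "0 < lam"
    and "lipschitz_on_bounded_sets F" "F 0 = 0" "\<And>s. s * F s \<le> 0"
    and "continuous_on UNIV g" "\<And>t. norm (g t) \<le> M"
  obtains u where "lattice_solution \<nu> lam F v g u"
    "\<And>t. 0 \<le> t \<Longrightarrow> lattice_cocycle \<nu> lam F t v g = u t"
proof -
  obtain u where u: "lattice_solution \<nu> lam F v g u"
    "\<And>w t. lattice_solution \<nu> lam F v g w \<Longrightarrow> 0 \<le> t \<Longrightarrow> w t = u t"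
    using lattice_solution_exists_unique[OF assms, of v] by blast
  show thesis
  proof (rule that[OF u(1)])
    fix t :: real
    assume "0 \<le> t"
    then show "lattice_cocycle \<nu> lam F t v g = u t"
      unfolding lattice_cocycle_def using u by (intro the_equality) blast+
  qed
qed

subsection \<open>Uniform tails of the hull\<close>

lemma topspace_compact_open_topology: "topspace compact_open_topology = {g. continuous_on UNIV g}"
proof -
  have "{g. continuous_on UNIV g \<and> g ` {} \<subseteq> (UNIV :: 'a set)}
      \<in> {{g :: real \<Rightarrow> 'a. continuous_on UNIV g \<and> g ` K \<subseteq> U} | K U. compact K \<and> open U}"
    by blast
  then show ?thesis
    unfolding compact_open_topology_def topology_generated_by_topspace by auto
qed

text \<open>A singleton is compact, so preimages of open sets under evaluation are among the
  generators of the topology.\<close>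

lemma continuous_map_evaluation:
  "continuous_map compact_open_topology euclidean (\<lambda>g :: real \<Rightarrow> 'a::topological_space. g t)"
  unfolding continuous_map_def
proof (intro conjI allI impI)
  fix U :: "'a set"
  assume "openin euclidean U"
  then have "openin compact_open_topology {g. continuous_on UNIV g \<and> g ` {t} \<subseteq> U}"
    unfolding compact_open_topology_def
    by (intro topology_generated_by_Basis CollectI exI[of _ "{t}"] exI[of _ U]) auto
  then show "openin compact_open_topology {g \<in> topspace compact_open_topology. g t \<in> U}"
    by (simp add: topspace_compact_open_topology)
qed auto

lemma hull_of_continuous: "g \<in> hull_of f \<Longrightarrow> continuous_on UNIV g"
  using closure_of_subset_topspace[of compact_open_topology]
  by (auto simp: hull_of_def topspace_compact_open_topology)

lemma shift_in_hull_of: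
  assumes "continuous_on UNIV f"
  shows "shift h f \<in> hull_of f"
proof -
  have "continuous_on UNIV (shift h f)" for h
    unfolding shift_def
    by (intro continuous_on_compose2[OF assms] continuous_intros) auto
  then have "range (\<lambda>h. shift h f) \<subseteq> topspace compact_open_topology"
    by (auto simp: topspace_compact_open_topology)
  from closure_of_subset[OF this] show ?thesis
    by (auto simp: hull_of_def)
qed

text \<open>Evaluation is continuous and sends every translate into \<open>range f\<close>. Bounds
  on the closure of the range thus hold for all \<open>g\<close> in the hull at all times.\<close>

lemma hull_of_values_in_closure:
  assumes "g \<in> hull_of f"
  shows "g t \<in> closure (range f)"
proof -
  have "(\<lambda>g. g t) ` hull_of f \<subseteq> euclidean closure_of ((\<lambda>g. g t) ` range (\<lambda>h. shift h f))"
    unfolding hull_of_def by (intro continuous_map_image_closure_subset continuous_map_evaluation)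
  moreover have "(\<lambda>g. g t) ` range (\<lambda>h. shift h f) \<subseteq> range f"
    by (auto simp: shift_def)
  ultimately have "(\<lambda>g. g t) ` hull_of f \<subseteq> closure (range f)"
    unfolding euclidean_closure_of by (blast dest: closure_mono)
  with assms show ?thesis
    by blast
qed

text \<open>Evaluation at 0 maps the compact hull onto a compact, hence closed, set. It contains
  \<open>range f\<close> because \<open>f h\<close> is the value of \<open>shift h f\<close> at
  0.\<close>

lemma compact_closure_range_if_translation_compact:
  fixes f :: "real \<Rightarrow> 'a::t2_space"
  assumes "translation_compact f"
  shows "compact (closure (range f))"
proof -
  have "compact ((\<lambda>g. g 0) ` hull_of f)"
    using image_compactin[OF _ continuous_map_evaluation[of 0], of "hull_of f"] assms
    by (simp add: translation_compact_def)
  moreover have "range f \<subseteq> (\<lambda>g. g 0) ` hull_of f"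
  proof
    fix x
    assume "x \<in> range f"
    then obtain h where "x = shift h f 0"
      by (auto simp: shift_def)
    then show "x \<in> (\<lambda>g. g 0) ` hull_of f"
      using shift_in_hull_of[of f h] assms by (auto simp: translation_compact_def)
  qed
  ultimately have "closure (range f) \<subseteq> (\<lambda>g. g 0) ` hull_of f"
    by (intro closure_minimal compact_imp_closed)
  with \<open>compact _\<close> show ?thesis
    by (metis closed_closure compact_Int_closed inf.absorb2)
qed

section \<open>Uniform tails on compact sets\<close>

text \<open>A finite set \<open>S\<close> carries all but \<open>e\<close> of the squared norm, and
  \<open>n\<close> exceeds its indices in absolute value. \<open>n\<close> is fixed before the
  weight, hence uniform over weights.\<close>

lemma ell2_tail_small:
  assumes "0 < e"
  obtains n :: nat where
    "\<And>\<theta>. lattice_weight \<theta> \<Longrightarrow> (\<And>i. \<bar>i\<bar> < int n \<Longrightarrow> \<theta> i = 0) \<Longrightarrow> inner (weighted \<theta> u) u \<le> e"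
proof -
  obtain S where S: "finite S" "dist (\<Sum>i\<in>S. (ell2_nth u i)\<^sup>2) (\<Sum>\<^sub>\<infinity>i. (ell2_nth u i)\<^sup>2) \<le> e"
    using infsum_finite_approximation[OF ell2_nth_summable \<open>0 < e\<close>, of u] by blast
  obtain n where n: "\<forall>i\<in>S. nat \<bar>i\<bar> < n"
    using finite_nat_set_iff_bounded[of "(\<lambda>i. nat \<bar>i\<bar>) ` S"] S(1) by auto
  show thesis
  proof
    fix \<theta>
    assume "lattice_weight \<theta>" and zero: "\<And>i. \<bar>i\<bar> < int n \<Longrightarrow> \<theta> i = 0"
    interpret lattice_weight \<theta> by fact
    have "inner (weighted \<theta> u) u \<le> (\<Sum>\<^sub>\<infinity>i\<in>UNIV - S. (ell2_nth u i)\<^sup>2)"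
      unfolding inner_weighted
    proof (rule infsum_mono_neutral)
      show "(\<lambda>i. (ell2_nth u i)\<^sup>2) summable_on UNIV - S"
        by (rule summable_on_subset_banach[OF ell2_nth_summable]) auto
      show "\<theta> i * (ell2_nth u i * ell2_nth u i) \<le> (ell2_nth u i)\<^sup>2" for i
        using nonneg[of i] le_1[of i] by (simp add: power2_eq_square mult_left_le_one_le)
      show "\<theta> i * (ell2_nth u i * ell2_nth u i) \<le> 0" if "i \<in> UNIV - (UNIV - S)" for i
        using that n zero[of i] by force
    qed (auto intro: summable_weighted)
    also have "\<dots> = (\<Sum>\<^sub>\<infinity>i. (ell2_nth u i)\<^sup>2) - (\<Sum>i\<in>S. (ell2_nth u i)\<^sup>2)"
      using S(1) by (subst infsum_Diff) (auto intro: ell2_nth_summable)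
    also have "\<dots> \<le> e"
      using S(2) by (simp add: dist_real_def)
    finally show "inner (weighted \<theta> u) u \<le> e" .
  qed
qed

lemma compact_uniform_tails:
  assumes "compact A" "0 < e"
  obtains n :: nat where
    "\<And>\<theta> u. lattice_weight \<theta> \<Longrightarrow> (\<And>i. \<bar>i\<bar> < int n \<Longrightarrow> \<theta> i = 0) \<Longrightarrow> u \<in> A \<Longrightarrow>
      inner (weighted \<theta> u) u \<le> e"
proof -
  \<comment> \<open>With this radius the weighted energy of \<open>u - x\<close> is at most e / 4.
    Young's inequality bounds that of \<open>u\<close> by twice the sum of those of \<open>x\<close>
    and \<open>u - x\<close>, which gives \<open>e\<close>.\<close>
  have "0 < sqrt e / 2"
    using assms(2) by simp
  then obtain X where X: "finite X" "A \<subseteq> (\<Union>x\<in>X. ball x (sqrt e / 2))"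
    using assms(1) unfolding compact_eq_totally_bounded by blast
  have "\<exists>n :: nat. \<forall>\<theta>. lattice_weight \<theta> \<longrightarrow> (\<forall>i. \<bar>i\<bar> < int n \<longrightarrow> \<theta> i = 0) \<longrightarrow>
      inner (weighted \<theta> x) x \<le> e / 4" for x
    using ell2_tail_small[of "e / 4" x] assms(2) by (metis divide_pos_pos zero_less_numeral)
  then obtain n :: "ell2 \<Rightarrow> nat" where n: "\<And>x \<theta>. lattice_weight \<theta> \<Longrightarrow>
      (\<And>i. \<bar>i\<bar> < int (n x) \<Longrightarrow> \<theta> i = 0) \<Longrightarrow> inner (weighted \<theta> x) x \<le> e / 4"
    by metis
  show thesis
  \<comment> \<open>Inserting 0 keeps \<open>Max\<close> meaningful when the net \<open>X\<close> is
    empty.\<close>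
  proof (rule that[of "Max (insert 0 (n ` X))"])
    fix \<theta> u
    assume \<theta>: "lattice_weight \<theta>" "\<And>i. \<bar>i\<bar> < int (Max (insert 0 (n ` X))) \<Longrightarrow> \<theta> i = 0"
      and "u \<in> A"
    interpret lattice_weight \<theta> by fact
    obtain x where x: "x \<in> X" "dist x u < sqrt e / 2"
      using \<open>u \<in> A\<close> X(2) by auto
    define d where "d = u - x"
    have "n x \<le> Max (insert 0 (n ` X))"
      using X(1) x(1) by (intro Max_ge) auto
    then have tail_x: "inner (weighted \<theta> x) x \<le> e / 4"
      by (intro n \<theta>) linarith+
    have "norm d \<le> sqrt e / 2"
      using x(2) by (simp add: d_def dist_norm norm_minus_commute)
    then have "(norm d)\<^sup>2 \<le> e / 4"
      using assms(2) power_mono[of "norm d" "sqrt e / 2" 2] by (simp add: power_divide)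
    then have tail_d: "inner (weighted \<theta> d) d \<le> e / 4"
      using inner_weighted_le[of d] by linarith
    have "inner (weighted \<theta> u) u = inner (weighted \<theta> (x + d)) (x + d)"
      by (simp add: d_def)
    also have "\<dots> = inner (weighted \<theta> x) x + 2 * inner (weighted \<theta> x) d + inner (weighted \<theta> d) d"
      using inner_weighted_commute[of x d]
      by (simp add: linear_add[OF bounded_linear.linear[OF bounded_linear_weighted]] inner_add
          inner_commute)
    finally show "inner (weighted \<theta> u) u \<le> e"
      using inner_weighted_young[of 1 x d] tail_x tail_d by simp
  qed
qed

subsection \<open>Asymptotic tails\<close>

definition cutoff :: "real \<Rightarrow> int \<Rightarrow> real" where
  "cutoff K i = max 0 (min 1 (\<bar>of_int i\<bar> / K - 1))"

lemma lattice_weight_cutoff: "lattice_weight (cutoff K)"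
  by unfold_locales (auto simp: cutoff_def)

lemma cutoff_eq_0: "0 < K \<Longrightarrow> \<bar>of_int i\<bar> \<le> K \<Longrightarrow> cutoff K i = 0"
  by (simp add: cutoff_def max_def min_def divide_simps)

lemma cutoff_eq_1: "0 < K \<Longrightarrow> 2 * K \<le> \<bar>of_int i\<bar> \<Longrightarrow> cutoff K i = 1"
  by (simp add: cutoff_def field_simps)

text \<open>One lattice step changes \<bar>i\<bar> / K by at most 1 / K, and clipping to [0, 1] does
  not enlarge increments.\<close>

lemma cutoff_slowly_varying:
  assumes "0 < K"
  shows "cutoff K (i + 1) \<le> cutoff K i + 1 / K" "cutoff K i \<le> cutoff K (i + 1) + 1 / K"
proof -
  have "\<bar>of_int (i + 1)\<bar> / K \<le> (\<bar>of_int i\<bar> + 1) / K" "\<bar>of_int i\<bar> / K \<le> (\<bar>of_int (i + 1)\<bar> + 1) / K"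
    using assms by (intro divide_right_mono; simp)+
  moreover have "0 < 1 / K"
    using assms by simp
  ultimately show "cutoff K (i + 1) \<le> cutoff K i + 1 / K" "cutoff K i \<le> cutoff K (i + 1) + 1 / K"
    unfolding cutoff_def add_divide_distrib by linarith+
qed

lemma tail_le_inner_cutoff:
  assumes "0 < K"
  shows "(\<Sum>\<^sub>\<infinity>k\<in>{k. \<bar>k\<bar> \<ge> int (2 * K)}. \<bar>ell2_nth u k\<bar>\<^sup>2) \<le> inner (weighted (cutoff (real K)) u) u"
proof -
  interpret lattice_weight "cutoff (real K)"
    by (rule lattice_weight_cutoff)
  show ?thesis
    unfolding inner_weighted
  proof (rule infsum_mono_neutral[OF _ summable_weighted])
    show "(\<lambda>k. \<bar>ell2_nth u k\<bar>\<^sup>2) summable_on {k. \<bar>k\<bar> \<ge> int (2 * K)}"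
      using summable_on_subset_banach[OF ell2_nth_summable[of u]] by simp
    show "\<bar>ell2_nth u k\<bar>\<^sup>2 \<le> cutoff (real K) k * (ell2_nth u k * ell2_nth u k)"
      if "k \<in> {k. \<bar>k\<bar> \<ge> int (2 * K)} \<inter> UNIV" for k
    proof -
      have "int (2 * K) \<le> \<bar>k\<bar>"
        using that by simp
      then have "real_of_int (int (2 * K)) \<le> real_of_int \<bar>k\<bar>"
        by (simp only: of_int_le_iff)
      then have "cutoff (real K) k = 1"
        using assms by (intro cutoff_eq_1) auto
      then show ?thesis
        by (simp add: power2_eq_square)
    qed
    show "0 \<le> cutoff (real K) k * (ell2_nth u k * ell2_nth u k)" for k
      using nonneg[of k] by simp
  qed auto
qed

text \<open>The norm bound \<open>B + M\<^sup>2 / lam\<^sup>2\<close> controls the error of the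
  cutoff, whose increments are at most 1 / K. The estimate depends on \<open>v\<close> and
  \<open>g\<close> only through \<open>B\<close>, \<open>M\<close> and \<eta>, hence is uniform over
  \<open>Q\<close> and the hull.\<close>

lemma lattice_cocycle_tail_le:
  assumes "0 < \<nu>" "0 < lam"
    and "lipschitz_on_bounded_sets F" "F 0 = 0" "\<And>s. s * F s \<le> 0"
    and "continuous_on UNIV g" "\<And>t. norm (g t) \<le> M"
    and "0 < K" "\<And>t. inner (weighted (cutoff (real K)) (g t)) (g t) \<le> \<eta>"
    and "(norm v)\<^sup>2 \<le> B" "0 \<le> t"
  shows "(\<Sum>\<^sub>\<infinity>k\<in>{k. \<bar>k\<bar> \<ge> int (2 * K)}. \<bar>ell2_nth (lattice_cocycle \<nu> lam F t v g) k\<bar>\<^sup>2)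
    \<le> exp (- lam * t) * B + (2 * \<nu> * (1 / real K) * (B + M\<^sup>2 / lam\<^sup>2) + \<eta> / lam) / lam"
proof -
  obtain u where u: "lattice_solution \<nu> lam F v g u"
    and cocycle: "\<And>t. 0 \<le> t \<Longrightarrow> lattice_cocycle \<nu> lam F t v g = u t"
    using lattice_cocycle_eq_solution[OF assms(1-7)] by blast
  have "(\<Sum>\<^sub>\<infinity>k\<in>{k. \<bar>k\<bar> \<ge> int (2 * K)}. \<bar>ell2_nth (lattice_cocycle \<nu> lam F t v g) k\<bar>\<^sup>2)
      \<le> inner (weighted (cutoff (real K)) (u t)) (u t)"
    unfolding cocycle[OF \<open>0 \<le> t\<close>] by (rule tail_le_inner_cutoff) fact
  also have "\<dots> \<le> exp (- lam * t) * (norm v)\<^sup>2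
      + (2 * \<nu> * (1 / real K) * (B + M\<^sup>2 / lam\<^sup>2) + \<eta> / lam) / lam"
  proof (rule lattice_solution_weighted_le[OF lattice_weight_cutoff assms(1-5) u])
    fix s :: real
    assume "0 \<le> s"
    then have "(norm (u s))\<^sup>2 \<le> (norm v)\<^sup>2 + M\<^sup>2 / lam\<^sup>2"
      by (rule lattice_solution_bounded[OF assms(1-5) u assms(7)])
    then show "2 * \<nu> * (1 / real K) * (norm (u s))\<^sup>2 \<le> 2 * \<nu> * (1 / real K) * (B + M\<^sup>2 / lam\<^sup>2)"
      using assms(1,8,10) by (intro mult_left_mono) auto
  qed (use assms(8,9,11) cutoff_slowly_varying in auto)
  also have "exp (- lam * t) * (norm v)\<^sup>2 \<le> exp (- lam * t) * B"
    using assms(10) by (intro mult_left_mono) auto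
  finally show ?thesis
    by simp
qed

theorem theorem4p5:
  fixes \<nu> lam \<alpha> C :: real
    and f :: "real \<Rightarrow> ell2"
    and F :: "real \<Rightarrow> real"
    and Q :: "ell2 set"
  assumes "\<nu> > 0" "lam > 0" "\<alpha> > 0"
    and "continuous_on UNIV f"
    and "translation_compact f"
    and "continuous_on UNIV F"
    and "lipschitz_on_bounded_sets F"
    and "F 0 = 0"
    and "\<And>s. s * F s \<le> - \<alpha> * s\<^sup>2"
  defines "C \<equiv> (SUP t. norm (f t))"
    and "Q \<equiv> {u. (norm u)\<^sup>2 \<le> 1 + C\<^sup>2 / (lam * (lam + 2 * \<alpha>))}"
  shows "asymptotic_tails_on (lattice_cocycle \<nu> lam F) (hull_of f) Q"
  unfolding asymptotic_tails_on_def
proof (intro allI impI)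
  fix \<epsilon> :: real
  assume \<epsilon>: "0 < \<epsilon>"
  define B where "B = 1 + C\<^sup>2 / (lam * (lam + 2 * \<alpha>))"
  have B: "0 \<le> B"
    using assms(2,3) by (simp add: B_def)
  have sign: "s * F s \<le> 0" for s
    using assms(9)[of s] assms(3) by (smt (verit) mult_minus_left mult_nonneg_nonneg zero_le_power2)
  have compact: "compact (closure (range f))"
    by (rule compact_closure_range_if_translation_compact) fact
  obtain M where M: "\<And>x. x \<in> closure (range f) \<Longrightarrow> norm x \<le> M"
    using compact_imp_bounded[OF compact] by (auto simp: bounded_iff)
  \<comment> \<open>Two divisions by \<open>lam\<close> turn \<eta> into \<epsilon> / 4. The cutoff
    error will contribute another \<epsilon> / 4, and the decaying initial energy less than
    \<epsilon> / 2.\<close>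
  define \<eta> where "\<eta> = \<epsilon> * lam\<^sup>2 / 4"
  have "0 < \<eta>"
    using \<epsilon> assms(2) by (simp add: \<eta>_def)
  obtain n where n: "\<And>\<theta> u. lattice_weight \<theta> \<Longrightarrow> (\<And>i. \<bar>i\<bar> < int n \<Longrightarrow> \<theta> i = 0) \<Longrightarrow>
      u \<in> closure (range f) \<Longrightarrow> inner (weighted \<theta> u) u \<le> \<eta>"
    using compact_uniform_tails[OF compact \<open>0 < \<eta>\<close>] by blast
  obtain m :: nat where m: "8 * \<nu> * (B + M\<^sup>2 / lam\<^sup>2) / (\<epsilon> * lam) \<le> real m"
    using real_arch_simple by blast
  \<comment> \<open>\<open>n\<close> makes the cutoff vanish where the hull's tails are not yet
    small, \<open>m\<close> makes its slope 1 / K small enough, and 1 keeps \<open>K\<close>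
    positive.\<close>
  define K where "K = n + m + 1"
  \<comment> \<open>Since \<open>exp (lam * t)\<close> exceeds \<open>lam * L\<close> for t \<ge> L,
    it suffices that B < \<epsilon> / 2 * (lam * L). The summand 1 makes this strict and keeps
    \<open>L\<close> positive.\<close>
  define L where "L = 1 + 2 * B / (\<epsilon> * lam)"
  have "0 < K"
    by (simp add: K_def)
  have "8 * \<nu> * (B + M\<^sup>2 / lam\<^sup>2) / (\<epsilon> * lam) \<le> real K"
    using m by (simp add: K_def)
  then have K: "2 * \<nu> * (1 / real K) * (B + M\<^sup>2 / lam\<^sup>2) \<le> \<epsilon> * lam / 4"
    using \<epsilon> assms(2) \<open>0 < K\<close> by (simp add: pos_divide_le_eq pos_le_divide_eq mult_ac)
  have "0 < L"
    using B \<epsilon> assms(2) by (simp add: L_def add_pos_nonneg)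
  \<comment> \<open>The witness for \<open>k\<^sub>0\<close> is \<open>2 * K\<close>, where the
    cutoff has reached 1.\<close>
  moreover have "(\<Sum>\<^sub>\<infinity>k\<in>{k. \<bar>k\<bar> \<ge> int (2 * K)}. \<bar>ell2_nth (lattice_cocycle \<nu> lam F t v g) k\<bar>\<^sup>2) < \<epsilon>"
    if "L \<le> t" "v \<in> Q" "g \<in> hull_of f" for t v g
  proof -
    have g: "g s \<in> closure (range f)" for s
      by (rule hull_of_values_in_closure) fact
    have "inner (weighted (cutoff (real K)) (g s)) (g s) \<le> \<eta>" for s
      by (intro n lattice_weight_cutoff g cutoff_eq_0) (auto simp: K_def)
    then have "(\<Sum>\<^sub>\<infinity>k\<in>{k. \<bar>k\<bar> \<ge> int (2 * K)}. \<bar>ell2_nth (lattice_cocycle \<nu> lam F t v g) k\<bar>\<^sup>2)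
        \<le> exp (- lam * t) * B + (2 * \<nu> * (1 / real K) * (B + M\<^sup>2 / lam\<^sup>2) + \<eta> / lam) / lam"
      using that \<open>0 < L\<close>
      by (intro lattice_cocycle_tail_le assms(1,2,7,8) sign hull_of_continuous[of g f] M g \<open>0 < K\<close>)
        (auto simp: Q_def B_def)
    also have "\<dots> \<le> exp (- lam * t) * B + (\<epsilon> * lam / 4 + \<eta> / lam) / lam"
      using K assms(2) by (intro add_left_mono divide_right_mono add_right_mono) auto
    also have "\<dots> = exp (- lam * t) * B + \<epsilon> / 2"
      using assms(2) by (simp add: \<eta>_def power2_eq_square field_simps)
    also have "exp (- lam * t) * B < \<epsilon> / 2"
    proof -
      have "B < \<epsilon> / 2 * (lam * L)"
        using \<epsilon> assms(2) by (simp add: L_def field_simps)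
      also have "lam * L \<le> exp (lam * t)"
        using exp_ge_add_one_self[of "lam * t"] mult_left_mono[OF that(1), of lam] assms(2)
        by linarith
      finally show ?thesis
        using \<epsilon> by (simp add: exp_minus field_simps)
    qed
    finally show ?thesis
      by simp
  qed
  ultimately show "\<exists>L>0. \<exists>k\<^sub>0::nat. \<forall>t\<ge>L. \<forall>v\<in>Q. \<forall>g\<in>hull_of f.
      (\<Sum>\<^sub>\<infinity>k\<in>{k. \<bar>k\<bar> \<ge> int k\<^sub>0}. \<bar>ell2_nth (lattice_cocycle \<nu> lam F t v g) k\<bar>\<^sup>2) < \<epsilon>"
    by blast
qed

end
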